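(* Let $p$ be a prime and let $\mathcal A$ be a finite set of powers of $p$ with $1\in\mathcal A$ and $|\mathcal A|\ge 2$. Then there exists a finite $p$-group $G$ of nilpotence class $2$ which is nested by degrees and satisfies $\mathrm{cd}(G)=\mathcal A$.
   Context: $\mathrm{cd}(G)=\{\chi(1):\chi\in\mathrm{Irr}(G)\}$ is the set of irreducible character degrees. For $\chi\in\mathrm{Irr}(G)$, $Z(\chi)=\{g\in G: |\chi(g)|=\chi(1)\}$. A group $G$ is nested by degrees if for all $\chi,\psi\in\mathrm{Irr}(G)$ with $\psi(1)\le\chi(1)$ we have $Z(\chi)\le Z(\psi)$. *)

theory Defs
  imports "HOL-Algebra.Group" "HOL-Algebra.Generated_Groups" "Jordan_Normal_Form.Matrix"
begin

definition mat_trace :: "complex mat \<Rightarrow> complex" where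
  "mat_trace A = (\<Sum>i<dim_row A. A $$ (i, i))"

definition is_rep :: "('g, 'b) monoid_scheme \<Rightarrow> nat \<Rightarrow> ('g \<Rightarrow> complex mat) \<Rightarrow> bool" where
  "is_rep G n \<rho> \<longleftrightarrow> 0 < n \<and>
     (\<forall>g \<in> carrier G. \<rho> g \<in> carrier_mat n n) \<and>
     \<rho> \<one>\<^bsub>G\<^esub> = 1\<^sub>m n \<and>
     (\<forall>x \<in> carrier G. \<forall>y \<in> carrier G. \<rho> (x \<otimes>\<^bsub>G\<^esub> y) = \<rho> x * \<rho> y)"

definition is_subspace :: "nat \<Rightarrow> complex vec set \<Rightarrow> bool" where
  "is_subspace n W \<longleftrightarrow> W \<subseteq> carrier_vec n \<and> 0\<^sub>v n \<in> W \<and>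
     (\<forall>v \<in> W. \<forall>w \<in> W. v + w \<in> W) \<and> (\<forall>c. \<forall>v \<in> W. c \<cdot>\<^sub>v v \<in> W)"

definition is_irr_rep :: "('g, 'b) monoid_scheme \<Rightarrow> nat \<Rightarrow> ('g \<Rightarrow> complex mat) \<Rightarrow> bool" where
  "is_irr_rep G n \<rho> \<longleftrightarrow> is_rep G n \<rho> \<and>
     (\<forall>W. is_subspace n W \<and> (\<forall>g \<in> carrier G. \<forall>w \<in> W. \<rho> g *\<^sub>v w \<in> W)
          \<longrightarrow> W = {0\<^sub>v n} \<or> W = carrier_vec n)"

definition Irr :: "('g, 'b) monoid_scheme \<Rightarrow> ('g \<Rightarrow> complex) set" where
  "Irr G = {restrict (\<lambda>g. mat_trace (\<rho> g)) (carrier G) | \<rho> n. is_irr_rep G n \<rho>}"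

definition cd :: "('g, 'b) monoid_scheme \<Rightarrow> complex set" where
  "cd G = (\<lambda>\<chi>. \<chi> \<one>\<^bsub>G\<^esub>) ` Irr G"

definition char_center :: "('g, 'b) monoid_scheme \<Rightarrow> ('g \<Rightarrow> complex) \<Rightarrow> 'g set" where
  "char_center G \<chi> = {g \<in> carrier G. complex_of_real (cmod (\<chi> g)) = \<chi> \<one>\<^bsub>G\<^esub>}"

(* nested by degrees; chi(1) is a positive integer, compared via its real part *)
definition nested_by_degrees :: "('g, 'b) monoid_scheme \<Rightarrow> bool" where
  "nested_by_degrees G \<longleftrightarrow> (\<forall>\<chi> \<in> Irr G. \<forall>\<psi> \<in> Irr G.
     Re (\<psi> \<one>\<^bsub>G\<^esub>) \<le> Re (\<chi> \<one>\<^bsub>G\<^esub>) \<longrightarrow> char_center G \<chi> \<subseteq> char_center G \<psi>)"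

definition grp_comm :: "('g, 'b) monoid_scheme \<Rightarrow> 'g \<Rightarrow> 'g \<Rightarrow> 'g" where
  "grp_comm G x y = inv\<^bsub>G\<^esub> x \<otimes>\<^bsub>G\<^esub> inv\<^bsub>G\<^esub> y \<otimes>\<^bsub>G\<^esub> x \<otimes>\<^bsub>G\<^esub> y"

(* lower central series: gamma_1 = G (index 0 here), gamma_{i+1} = [gamma_i, G] *)
fun lower_central :: "('g, 'b) monoid_scheme \<Rightarrow> nat \<Rightarrow> 'g set" where
  "lower_central G 0 = carrier G"
| "lower_central G (Suc n) =
     generate G {grp_comm G x y | x y. x \<in> lower_central G n \<and> y \<in> carrier G}"

definition nilpotent_class :: "('g, 'b) monoid_scheme \<Rightarrow> nat \<Rightarrow> bool" where
  "nilpotent_class G c \<longleftrightarrow> lower_central G c = {\<one>\<^bsub>G\<^esub>} \<and>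
     (\<forall>k < c. lower_central G k \<noteq> {\<one>\<^bsub>G\<^esub>})"

definition finite_p_group :: "nat \<Rightarrow> ('g, 'b) monoid_scheme \<Rightarrow> bool" where
  "finite_p_group p G \<longleftrightarrow> group G \<and> finite (carrier G) \<and> (\<exists>k. order G = p ^ k)"

end

theory Submission
  imports Defs
    "HOL-Algebra.Multiplicative_Group"
    "HOL-Computational_Algebra.Formal_Power_Series"
    "HOL-Number_Theory.Cong"
    "Jordan_Normal_Form.Spectral_Radius"
begin

text \<open>
  Let \<open>S\<close> be the set of all \<open>e - 1\<close> with \<open>e > 0\<close> and \<open>p^e \<in> A\<close>. The group consists of triples
  \<open>(a, b, z)\<close> with \<open>a\<close>, \<open>b\<close> truncated polynomials over \<open>F_p\<close> and \<open>z\<close> a family of elements of \<open>F_p\<close>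
  indexed by \<open>S\<close>, multiplied by \<open>(a, b, z) (a', b', z') = (a + a', b + b', z + z' + a b')\<close>, where only
  the coefficients of \<open>a b'\<close> with index in \<open>S\<close> are kept. An irreducible representation restricts to
  a linear character of the central subgroup of all \<open>(0, 0, z)\<close>; let \<open>e - 1\<close> be the least index such
  that this character is trivial on the \<open>z\<close> supported above it (\<open>e = 0\<close> for the trivial character).
  The matrix of the commutator form composed with the character is anti-triangular of size \<open>e\<close>, so its
  radical is the set of \<open>(a, b, z)\<close> for which the first \<open>e\<close> coefficients of \<open>a\<close> and \<open>b\<close> vanish.
  The representation is scalar on this radical, its character vanishes elsewhere, and its degree is
  \<open>p^e\<close>. Hence the centers of the characters form a chain governed by the degrees.
\<close>

section \<open>Traces, irreducible representations and degrees\<close>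

lemma mat_trace_mult_comm:
  assumes "A \<in> carrier_mat n n" "B \<in> carrier_mat n n"
  shows "mat_trace (A * B) = mat_trace (B * A)"
proof -
  have "mat_trace (A * B) = (\<Sum>i<n. \<Sum>j<n. A $$ (i,j) * B $$ (j,i))"
    using assms by (auto simp: mat_trace_def scalar_prod_def lessThan_atLeast0 intro!: sum.cong)
  also have "\<dots> = (\<Sum>j<n. \<Sum>i<n. A $$ (i,j) * B $$ (j,i))"
    by (rule sum.swap)
  also have "\<dots> = mat_trace (B * A)"
    using assms by (auto simp: mat_trace_def scalar_prod_def lessThan_atLeast0 intro!: sum.cong)
  finally show ?thesis .
qed

lemma mat_trace_smult:
  "A \<in> carrier_mat n n \<Longrightarrow> mat_trace (c \<cdot>\<^sub>m A) = c * mat_trace A"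
  by (auto simp: mat_trace_def sum_distrib_left intro!: sum.cong)

lemma mat_trace_one: "mat_trace (1\<^sub>m n) = of_nat n"
  by (auto simp: mat_trace_def)

lemma mult_mat_vec_unit:
  fixes A :: "complex mat"
  assumes "A \<in> carrier_mat m n" "j < n"
  shows "A *\<^sub>v unit_vec n j = col A j"
  using assms by (intro eq_vecI) (auto simp: scalar_prod_right_unit)

lemma mat_eqI_mult_vec:
  fixes A B :: "complex mat"
  assumes "A \<in> carrier_mat m n" "B \<in> carrier_mat m n"
    and "\<And>v. v \<in> carrier_vec n \<Longrightarrow> A *\<^sub>v v = B *\<^sub>v v"
  shows "A = B"
proof (rule mat_col_eqI)
  fix j assume "j < dim_col B"
  then have j: "j < n" using assms by auto
  have "A *\<^sub>v unit_vec n j = B *\<^sub>v unit_vec n j" using assms(3) by simp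
  then show "col A j = col B j"
    using mult_mat_vec_unit[OF assms(1) j] mult_mat_vec_unit[OF assms(2) j] by simp
qed (use assms in auto)

lemma mult_mat_zero_vec: "A \<in> carrier_mat m n \<Longrightarrow> A *\<^sub>v 0\<^sub>v n = 0\<^sub>v m"
  by (intro eq_vecI) auto

lemma smult_mat_mult_vec:
  fixes A :: "complex mat"
  assumes "A \<in> carrier_mat n m" "v \<in> carrier_vec m"
  shows "(c \<cdot>\<^sub>m A) *\<^sub>v v = c \<cdot>\<^sub>v (A *\<^sub>v v)"
  using assms by (intro eq_vecI) (auto simp: scalar_prod_def sum_distrib_left mult.assoc)

lemma is_repD:
  assumes "is_rep G n \<rho>"
  shows "0 < n" "g \<in> carrier G \<Longrightarrow> \<rho> g \<in> carrier_mat n n" "\<rho> \<one>\<^bsub>G\<^esub> = 1\<^sub>m n"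
    "g \<in> carrier G \<Longrightarrow> h \<in> carrier G \<Longrightarrow> \<rho> (g \<otimes>\<^bsub>G\<^esub> h) = \<rho> g * \<rho> h"
  using assms by (auto simp: is_rep_def)

lemma is_irr_repD:
  assumes "is_irr_rep G n \<rho>" "is_subspace n W"
    "\<And>g w. g \<in> carrier G \<Longrightarrow> w \<in> W \<Longrightarrow> \<rho> g *\<^sub>v w \<in> W"
  shows "W = {0\<^sub>v n} \<or> W = carrier_vec n"
  using assms by (auto simp: is_irr_rep_def)

text \<open>Over the complex numbers \<open>M\<close> has an eigenvalue. Its eigenspace is nonzero,
  and invariant because \<open>M\<close> commutes with the representation, so it is the whole
  space.\<close>

lemma schur:
  assumes irr: "is_irr_rep G n \<rho>" and M: "M \<in> carrier_mat n n"
    and comm: "\<And>g. g \<in> carrier G \<Longrightarrow> \<rho> g * M = M * \<rho> g"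
  shows "\<exists>c. M = c \<cdot>\<^sub>m 1\<^sub>m n"
proof -
  have rep: "is_rep G n \<rho>" using irr by (auto simp: is_irr_rep_def)
  note R = is_repD[OF rep]
  obtain c where "c \<in> spectrum M" using spectrum_non_empty[OF M R(1)] by auto
  then have "eigenvalue M c" by (simp add: spectrum_def)
  then obtain v where v: "v \<in> carrier_vec n" "v \<noteq> 0\<^sub>v n" "M *\<^sub>v v = c \<cdot>\<^sub>v v"
    using M by (auto simp: eigenvalue_def eigenvector_def)
  define W where "W = {w \<in> carrier_vec n. M *\<^sub>v w = c \<cdot>\<^sub>v w}"
  have "is_subspace n W"
    unfolding is_subspace_def W_def using M
    by (auto simp: mult_add_distrib_mat_vec smult_add_distrib_vec mult_mat_vec smult_smult_assoc mult.commute)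
  moreover have "\<rho> g *\<^sub>v w \<in> W" if g: "g \<in> carrier G" and w: "w \<in> W" for g w
  proof -
    have wc: "w \<in> carrier_vec n" "M *\<^sub>v w = c \<cdot>\<^sub>v w" using w by (auto simp: W_def)
    have "M *\<^sub>v (\<rho> g *\<^sub>v w) = \<rho> g *\<^sub>v (M *\<^sub>v w)"
      using assoc_mult_mat_vec[OF M R(2)[OF g] wc(1)] assoc_mult_mat_vec[OF R(2)[OF g] M wc(1)]
        comm[OF g] by simp
    then show ?thesis using R(2)[OF g] wc by (auto simp: W_def mult_mat_vec)
  qed
  ultimately have "W = {0\<^sub>v n} \<or> W = carrier_vec n" using is_irr_repD[OF irr] by blast
  moreover have "v \<in> W" using v by (auto simp: W_def)
  ultimately have W: "W = carrier_vec n" using v by auto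
  have "M = c \<cdot>\<^sub>m 1\<^sub>m n"
  proof (rule mat_eqI_mult_vec[OF M])
    fix w :: "complex vec" assume w: "w \<in> carrier_vec n"
    then have "M *\<^sub>v w = c \<cdot>\<^sub>v w" using W by (auto simp: W_def)
    then show "M *\<^sub>v w = (c \<cdot>\<^sub>m 1\<^sub>m n) *\<^sub>v w"
      using smult_mat_mult_vec[OF one_carrier_mat w] w by simp
  qed simp
  then show ?thesis by blast
qed

section \<open>Traces of scalar elements and of elements that commute up to a factor\<close>

lemma rep_pow:
  assumes "group G" "is_rep G n \<rho>" "g \<in> carrier G"
  shows "\<rho> (g [^]\<^bsub>G\<^esub> (k::nat)) = \<rho> g ^\<^sub>m k"
proof -
  interpret group G by fact
  note R = is_repD[OF assms(2)]
  have "dim_row (\<rho> g) = n" using R(2)[OF assms(3)] by simp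
  then show ?thesis by (induction k) (use assms in \<open>simp_all add: R\<close>)
qed

text \<open>The finite order of \<open>g\<close> makes \<open>c\<close> a root of unity, so the
  trace \<open>c * n\<close> has modulus \<open>n\<close>.\<close>

lemma norm_trace_scalar:
  assumes "group G" "finite (carrier G)" "is_rep G n \<rho>" "g \<in> carrier G" "\<rho> g = c \<cdot>\<^sub>m 1\<^sub>m n"
  shows "cmod (mat_trace (\<rho> g)) = real n"
proof -
  interpret group G by fact
  note R = is_repD[OF assms(3)]
  define d where "d = card (carrier G)"
  have ord: "0 < d" using assms(2) by (auto simp: d_def card_gt_0_iff)
  have "g [^]\<^bsub>G\<^esub> d = \<one>\<^bsub>G\<^esub>"
    using pow_order_eq_1[OF assms(4)] by (simp add: d_def Coset.order_def)
  have pow: "(c \<cdot>\<^sub>m 1\<^sub>m n) ^\<^sub>m k = c ^ k \<cdot>\<^sub>m (1\<^sub>m n :: complex mat)" for k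
  proof (induction k)
    case (Suc k)
    have "(c ^ k \<cdot>\<^sub>m (1\<^sub>m n)) * (c \<cdot>\<^sub>m 1\<^sub>m n) = c ^ k \<cdot>\<^sub>m (c \<cdot>\<^sub>m (1\<^sub>m n :: complex mat))"
      using mult_smult_assoc_mat[of "1\<^sub>m n :: complex mat" n n "c \<cdot>\<^sub>m 1\<^sub>m n" n "c ^ k"] by simp
    also have "\<dots> = c ^ Suc k \<cdot>\<^sub>m 1\<^sub>m n" by (intro eq_matI) auto
    finally show ?case using Suc by simp
  qed (intro eq_matI, auto)
  have "c ^ d \<cdot>\<^sub>m 1\<^sub>m n = (1\<^sub>m n :: complex mat)"
    using rep_pow[OF assms(1,3,4), of d] \<open>g [^]\<^bsub>G\<^esub> d = \<one>\<^bsub>G\<^esub>\<close> R(3) assms(5) pow by simp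
  then have "(c ^ d \<cdot>\<^sub>m 1\<^sub>m n) $$ (0,0) = (1\<^sub>m n :: complex mat) $$ (0,0)" by simp
  then have "c ^ d = 1" using R(1) by simp
  then have "cmod c ^ d = 1" by (metis norm_power norm_one)
  then have "cmod c = 1" using ord power_eq_imp_eq_base[of "cmod c" d 1] by simp
  then show ?thesis
    by (simp add: assms(5) mat_trace_smult[OF one_carrier_mat] mat_trace_one norm_mult)
qed

text \<open>\<open>\<rho> g\<close> is \<open>c\<close> times its conjugate by
  \<open>\<rho> h\<close>. Conjugation preserves traces, so the trace is \<open>c\<close> times
  itself.\<close>

lemma trace_zero_if_twisted_comm:
  assumes "group G" "is_rep G n \<rho>" "g \<in> carrier G" "h \<in> carrier G"
    "\<rho> (g \<otimes>\<^bsub>G\<^esub> h) = c \<cdot>\<^sub>m \<rho> (h \<otimes>\<^bsub>G\<^esub> g)" "c \<noteq> 1"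
  shows "mat_trace (\<rho> g) = 0"
proof -
  interpret group G by fact
  note R = is_repD[OF assms(2)]
  let ?h = "inv\<^bsub>G\<^esub> h"
  have "\<rho> g = \<rho> (g \<otimes>\<^bsub>G\<^esub> h) * \<rho> ?h"
    using assms(3,4) by (simp add: R(4)[symmetric] m_assoc)
  also have "\<dots> = c \<cdot>\<^sub>m (\<rho> (h \<otimes>\<^bsub>G\<^esub> g) * \<rho> ?h)"
    unfolding assms(5) using assms(3,4) by (simp add: R(2) mult_smult_assoc_mat[of _ n n _ n])
  finally have "mat_trace (\<rho> g) = c * mat_trace (\<rho> (h \<otimes>\<^bsub>G\<^esub> g) * \<rho> ?h)"
    using assms by (metis R(2) inv_closed m_closed mat_trace_smult mult_carrier_mat)
  also have "\<dots> = c * mat_trace (\<rho> ?h * \<rho> (h \<otimes>\<^bsub>G\<^esub> g))"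
    using assms by (subst mat_trace_mult_comm[of _ n]) (auto intro: R(2))
  also have "\<rho> ?h * \<rho> (h \<otimes>\<^bsub>G\<^esub> g) = \<rho> g"
    using assms(3,4) by (simp add: R(4)[symmetric] m_assoc[symmetric])
  finally have "(1 - c) * mat_trace (\<rho> g) = 0" by (simp add: algebra_simps)
  then show ?thesis using assms by simp
qed

text \<open>The type of matrices does not fix a size, so the sum is formed entrywise with size
  \<open>n\<close>; the empty sum is then the zero matrix of that size.\<close>

definition mat_sum_over :: "nat \<Rightarrow> ('a \<Rightarrow> complex mat) \<Rightarrow> 'a set \<Rightarrow> complex mat" where
  "mat_sum_over n f B = mat n n (\<lambda>ij. \<Sum>b\<in>B. f b $$ ij)"

lemma mat_sum_over_carrier [simp]: "mat_sum_over n f B \<in> carrier_mat n n"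
  by (simp add: mat_sum_over_def)

lemma mult_mat_sum_over:
  assumes "M \<in> carrier_mat n n" "\<And>b. b \<in> B \<Longrightarrow> f b \<in> carrier_mat n n"
  shows "M * mat_sum_over n f B = mat_sum_over n (\<lambda>b. M * f b) B"
proof (rule eq_matI)
  fix i j assume "i < dim_row (mat_sum_over n (\<lambda>b. M * f b) B)" "j < dim_col (mat_sum_over n (\<lambda>b. M * f b) B)"
  then have ij: "i < n" "j < n" by (auto simp: mat_sum_over_def)
  have "(M * mat_sum_over n f B) $$ (i,j) = (\<Sum>k<n. M $$ (i,k) * (\<Sum>b\<in>B. f b $$ (k,j)))"
    using ij assms by (auto simp: mat_sum_over_def scalar_prod_def lessThan_atLeast0)
  also have "\<dots> = (\<Sum>b\<in>B. \<Sum>k<n. M $$ (i,k) * f b $$ (k,j))"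
    by (simp add: sum_distrib_left sum.swap[of _ B])
  also have "\<dots> = mat_sum_over n (\<lambda>b. M * f b) B $$ (i,j)"
    using ij assms by (force simp: mat_sum_over_def scalar_prod_def lessThan_atLeast0 intro!: sum.cong)
  finally show "(M * mat_sum_over n f B) $$ (i,j) = mat_sum_over n (\<lambda>b. M * f b) B $$ (i,j)" .
qed (use assms in \<open>auto simp: mat_sum_over_def\<close>)

lemma mat_sum_over_mult:
  assumes "M \<in> carrier_mat n n" "\<And>b. b \<in> B \<Longrightarrow> f b \<in> carrier_mat n n"
  shows "mat_sum_over n f B * M = mat_sum_over n (\<lambda>b. f b * M) B"
proof (rule eq_matI)
  fix i j assume "i < dim_row (mat_sum_over n (\<lambda>b. f b * M) B)" "j < dim_col (mat_sum_over n (\<lambda>b. f b * M) B)"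
  then have ij: "i < n" "j < n" by (auto simp: mat_sum_over_def)
  have "(mat_sum_over n f B * M) $$ (i,j) = (\<Sum>k<n. (\<Sum>b\<in>B. f b $$ (i,k)) * M $$ (k,j))"
    using ij assms by (auto simp: mat_sum_over_def scalar_prod_def lessThan_atLeast0)
  also have "\<dots> = (\<Sum>b\<in>B. \<Sum>k<n. f b $$ (i,k) * M $$ (k,j))"
    by (simp add: sum_distrib_right sum.swap[of _ B])
  also have "\<dots> = mat_sum_over n (\<lambda>b. f b * M) B $$ (i,j)"
    using ij assms by (force simp: mat_sum_over_def scalar_prod_def lessThan_atLeast0 intro!: sum.cong)
  finally show "(mat_sum_over n f B * M) $$ (i,j) = mat_sum_over n (\<lambda>b. f b * M) B $$ (i,j)" .
qed (use assms in \<open>auto simp: mat_sum_over_def\<close>)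

lemma mat_trace_mat_sum_over:
  assumes "\<And>b. b \<in> B \<Longrightarrow> f b \<in> carrier_mat n n"
  shows "mat_trace (mat_sum_over n f B) = (\<Sum>b\<in>B. mat_trace (f b))"
proof -
  have "mat_trace (mat_sum_over n f B) = (\<Sum>i<n. \<Sum>b\<in>B. f b $$ (i,i))"
    by (simp add: mat_trace_def mat_sum_over_def)
  also have "\<dots> = (\<Sum>b\<in>B. \<Sum>i<n. f b $$ (i,i))"
    by (rule sum.swap)
  also have "\<dots> = (\<Sum>b\<in>B. mat_trace (f b))"
    using assms by (intro sum.cong) (auto simp: mat_trace_def)
  finally show ?thesis .
qed

lemma mat_sum_over_const:
  assumes "E \<in> carrier_mat n n" "\<And>b. b \<in> B \<Longrightarrow> f b = E"
  shows "mat_sum_over n f B = of_nat (card B) \<cdot>\<^sub>m E"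
  using assms by (intro eq_matI) (auto simp: mat_sum_over_def)


text \<open>
  The matrix \<open>E\<close>, the sum of \<open>\<rho> b\<close> over \<open>B\<close>, has trace \<open>n\<close> and is \<open>card B\<close> times an idempotent.
  Since \<open>E * \<rho> g * E\<close> is always a multiple of \<open>E\<close>, irreducibility forces \<open>E\<close> to have rank one,
  so its trace is \<open>card B\<close>.
\<close>

lemma degree_eq_card:
  assumes G: "group G" and irr: "is_irr_rep G n \<rho>"
    and B: "subgroup B G" "finite B"
    and tr: "\<And>b. b \<in> B \<Longrightarrow> b \<noteq> \<one>\<^bsub>G\<^esub> \<Longrightarrow> mat_trace (\<rho> b) = 0"
    and cases: "\<And>g. g \<in> carrier G \<Longrightarrow>
      (\<exists>c. \<exists>b\<in>B. \<rho> g = c \<cdot>\<^sub>m \<rho> b) \<or> (\<exists>c. \<exists>b\<in>B. c \<noteq> 1 \<and> \<rho> (g \<otimes>\<^bsub>G\<^esub> b) = c \<cdot>\<^sub>m \<rho> (b \<otimes>\<^bsub>G\<^esub> g))"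
  shows "n = card B"
proof -
  interpret group G by fact
  have rep: "is_rep G n \<rho>" using irr by (auto simp: is_irr_rep_def)
  note R = is_repD[OF rep]
  have BG: "b \<in> carrier G" if "b \<in> B" for b using B(1) that by (rule subgroup.mem_carrier)
  have one: "\<one>\<^bsub>G\<^esub> \<in> B" using B(1) by (rule subgroup.one_closed)
  define E where "E = mat_sum_over n \<rho> B"
  have E: "E \<in> carrier_mat n n" by (simp add: E_def)
  \<comment> \<open>Left translation by \<open>b\<close> permutes the summands of \<open>E\<close>,
    so \<open>E\<close> absorbs factors from \<open>B\<close>. Right translation gives the same on
    the other side.\<close>
  have left: "\<rho> b * E = E" if b: "b \<in> B" for b
  proof -
    have bij: "bij_betw (\<lambda>x. b \<otimes>\<^bsub>G\<^esub> x) B B"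
      by (rule bij_betwI[where g = "\<lambda>x. inv\<^bsub>G\<^esub> b \<otimes>\<^bsub>G\<^esub> x"])
         (use b B BG in \<open>auto simp: m_assoc[symmetric] subgroup.m_closed subgroup.m_inv_closed\<close>)
    have "\<rho> b * E = mat_sum_over n (\<lambda>x. \<rho> b * \<rho> x) B"
      unfolding E_def using b BG R(2) by (intro mult_mat_sum_over) auto
    also have "\<dots> = mat_sum_over n (\<lambda>x. \<rho> (b \<otimes>\<^bsub>G\<^esub> x)) B"
      using b BG R(4) by (auto simp: mat_sum_over_def)
    also have "\<dots> = E"
      unfolding E_def mat_sum_over_def
      by (intro arg_cong[of _ _ "mat n n"] ext sum.reindex_bij_betw[OF bij])
    finally show ?thesis .
  qed
  have right: "E * \<rho> b = E" if b: "b \<in> B" for b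
  proof -
    have bij: "bij_betw (\<lambda>x. x \<otimes>\<^bsub>G\<^esub> b) B B"
      by (rule bij_betwI[where g = "\<lambda>x. x \<otimes>\<^bsub>G\<^esub> inv\<^bsub>G\<^esub> b"])
         (use b B BG in \<open>auto simp: m_assoc subgroup.m_closed subgroup.m_inv_closed\<close>)
    have "E * \<rho> b = mat_sum_over n (\<lambda>x. \<rho> x * \<rho> b) B"
      unfolding E_def using b BG R(2) by (intro mat_sum_over_mult) auto
    also have "\<dots> = mat_sum_over n (\<lambda>x. \<rho> (x \<otimes>\<^bsub>G\<^esub> b)) B"
      using b BG R(4) by (auto simp: mat_sum_over_def)
    also have "\<dots> = E"
      unfolding E_def mat_sum_over_def
      by (intro arg_cong[of _ _ "mat n n"] ext sum.reindex_bij_betw[OF bij])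
    finally show ?thesis .
  qed
  have EE: "E * E = of_nat (card B) \<cdot>\<^sub>m E"
  proof -
    have "E * E = mat_sum_over n (\<lambda>x. \<rho> x * E) B"
      unfolding E_def by (rule mat_sum_over_mult) (use BG R(2) in auto)
    also have "\<dots> = of_nat (card B) \<cdot>\<^sub>m E"
      by (rule mat_sum_over_const) (use left E in auto)
    finally show ?thesis .
  qed
  \<comment> \<open>If \<open>\<rho> g\<close> is a multiple of some \<open>\<rho> b\<close>, then
    \<open>E\<close> absorbs \<open>\<rho> b\<close>. Otherwise moving \<open>b\<close> past
    \<open>g\<close> gives \<open>X = c * X\<close> for \<open>X = E * \<rho> g * E\<close> with
    \<open>c\<close> different from 1, so \<open>X = 0\<close>.\<close>
  have cut: "\<exists>c. E * \<rho> g * E = c \<cdot>\<^sub>m E" if g: "g \<in> carrier G" for g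
    using cases[OF g]
  proof
    assume "\<exists>c. \<exists>b\<in>B. \<rho> g = c \<cdot>\<^sub>m \<rho> b"
    then obtain c b where b: "b \<in> B" "\<rho> g = c \<cdot>\<^sub>m \<rho> b" by blast
    have "E * \<rho> g * E = c \<cdot>\<^sub>m (E * \<rho> b * E)"
      using E R(2)[OF BG[OF b(1)]] unfolding b(2)
      by (simp add: mult_smult_distrib[OF E] mult_smult_assoc_mat[of _ n n _ n])
    also have "\<dots> = (c * of_nat (card B)) \<cdot>\<^sub>m E"
      using E unfolding right[OF b(1)] EE by (intro eq_matI) auto
    finally show ?thesis by blast
  next
    assume "\<exists>c. \<exists>b\<in>B. c \<noteq> 1 \<and> \<rho> (g \<otimes>\<^bsub>G\<^esub> b) = c \<cdot>\<^sub>m \<rho> (b \<otimes>\<^bsub>G\<^esub> g)"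
    then obtain c b where b: "b \<in> B" "c \<noteq> 1" "\<rho> g * \<rho> b = c \<cdot>\<^sub>m (\<rho> b * \<rho> g)"
      using R(4) g BG by metis
    note Rb = R(2)[OF BG[OF b(1)]] and Rg = R(2)[OF g]
    have "E * \<rho> g * E = E * \<rho> g * (\<rho> b * E)" using left[OF b(1)] by simp
    also have "\<dots> = E * (\<rho> g * \<rho> b) * E" using E Rb Rg by (simp add: assoc_mult_mat[of _ n n _ n _ n])
    also have "\<dots> = c \<cdot>\<^sub>m (E * (\<rho> b * \<rho> g) * E)" unfolding b(3)
      using E Rb Rg by (simp add: mult_smult_distrib[OF E, of _ n] mult_smult_assoc_mat[of _ n n _ n])
    also have "E * (\<rho> b * \<rho> g) * E = E * \<rho> b * \<rho> g * E"
      using E Rb Rg by (simp add: assoc_mult_mat[of _ n n _ n _ n])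
    also have "E * \<rho> b = E" by (rule right[OF b(1)])
    finally have eq: "E * \<rho> g * E = c \<cdot>\<^sub>m (E * \<rho> g * E)" .
    define F where "F = E * \<rho> g * E"
    have F: "F \<in> carrier_mat n n" using E Rg by (simp add: F_def)
    have "F $$ (i,j) = 0" if ij: "i < n" "j < n" for i j
    proof -
      have "F $$ (i,j) = (c \<cdot>\<^sub>m F) $$ (i,j)" using eq unfolding F_def by (rule arg_cong)
      also have "\<dots> = c * F $$ (i,j)" using F ij by simp
      finally have "(1 - c) * F $$ (i,j) = 0" by (simp add: algebra_simps)
      then show ?thesis using b(2) by simp
    qed
    then have "F = 0 \<cdot>\<^sub>m E" using E F by (intro eq_matI) auto
    then show ?thesis unfolding F_def by blast
  qed
  have trE: "mat_trace E = of_nat n"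
  proof -
    have "mat_trace E = (\<Sum>b\<in>B. mat_trace (\<rho> b))"
      unfolding E_def by (rule mat_trace_mat_sum_over) (use BG R(2) in auto)
    also have "\<dots> = (\<Sum>b\<in>B. if b = \<one>\<^bsub>G\<^esub> then of_nat n else 0)"
      by (rule sum.cong) (use tr R(3) mat_trace_one in auto)
    also have "\<dots> = of_nat n" using one B(2) by simp
    finally show ?thesis .
  qed
  \<comment> \<open>The trace of \<open>E\<close> is \<open>n > 0\<close>, so some column is
    nonzero; it becomes the vector \<open>v\<close>.\<close>
  have "\<exists>j<n. col E j \<noteq> 0\<^sub>v n"
  proof (rule ccontr)
    assume "\<not> ?thesis"
    then have "E $$ (j,j) = 0" if "j < n" for j
      using that E by (metis carrier_matD index_col index_zero_vec(1))
    then have "mat_trace E = 0" using E by (simp add: mat_trace_def)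
    then show False using trE R(1) by simp
  qed
  then obtain j0 where j0: "j0 < n" "col E j0 \<noteq> 0\<^sub>v n" by blast
  define u where "u = (unit_vec n j0 :: complex vec)"
  define v where "v = E *\<^sub>v u"
  have u: "u \<in> carrier_vec n" by (simp add: u_def)
  have v: "v \<in> carrier_vec n" "v \<noteq> 0\<^sub>v n"
    using j0 E mult_mat_vec_unit[OF E j0(1)] by (auto simp: v_def u_def)
  \<comment> \<open>The vectors whose whole orbit is sent by \<open>E\<close> into the line of
    \<open>v\<close>. Quantifying over \<open>g\<close> makes \<open>W\<close> invariant, and
    \<open>cut\<close> puts \<open>v\<close> into it.\<close>
  define W where "W = {w \<in> carrier_vec n. \<forall>g\<in>carrier G. \<exists>c. E *\<^sub>v (\<rho> g *\<^sub>v w) = c \<cdot>\<^sub>v v}"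
  have "is_subspace n W"
    unfolding is_subspace_def
  proof (intro conjI ballI allI)
    show "W \<subseteq> carrier_vec n" by (auto simp: W_def)
    show "0\<^sub>v n \<in> W" using v(1) mult_mat_zero_vec[OF E] mult_mat_zero_vec[OF R(2)]
      by (auto simp: W_def intro!: exI[of _ 0] eq_vecI)
  next
    fix x y assume xy: "x \<in> W" "y \<in> W"
    have "\<exists>c. E *\<^sub>v (\<rho> g *\<^sub>v (x + y)) = c \<cdot>\<^sub>v v" if g: "g \<in> carrier G" for g
    proof -
      obtain c d where "E *\<^sub>v (\<rho> g *\<^sub>v x) = c \<cdot>\<^sub>v v" "E *\<^sub>v (\<rho> g *\<^sub>v y) = d \<cdot>\<^sub>v v"
        using xy g by (force simp: W_def)
      then have "E *\<^sub>v (\<rho> g *\<^sub>v (x + y)) = (c + d) \<cdot>\<^sub>v v"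
        using xy R(2)[OF g] E v(1)
        by (auto simp: W_def mult_add_distrib_mat_vec[of _ n n] add_smult_distrib_vec)
      then show ?thesis by blast
    qed
    then show "x + y \<in> W" using xy by (auto simp: W_def)
  next
    fix k x assume x: "x \<in> W"
    have "\<exists>c. E *\<^sub>v (\<rho> g *\<^sub>v (k \<cdot>\<^sub>v x)) = c \<cdot>\<^sub>v v" if g: "g \<in> carrier G" for g
    proof -
      obtain c where "E *\<^sub>v (\<rho> g *\<^sub>v x) = c \<cdot>\<^sub>v v" using x g by (force simp: W_def)
      then have "E *\<^sub>v (\<rho> g *\<^sub>v (k \<cdot>\<^sub>v x)) = (k * c) \<cdot>\<^sub>v v"
        using x R(2)[OF g] E v(1) by (auto simp: W_def mult_mat_vec[of _ n n] smult_smult_assoc)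
      then show ?thesis by blast
    qed
    then show "k \<cdot>\<^sub>v x \<in> W" using x by (auto simp: W_def)
  qed
  moreover have "\<rho> g *\<^sub>v w \<in> W" if g: "g \<in> carrier G" and w: "w \<in> W" for g w
  proof -
    have wc: "w \<in> carrier_vec n" using w by (simp add: W_def)
    have "\<rho> h *\<^sub>v (\<rho> g *\<^sub>v w) = \<rho> (h \<otimes>\<^bsub>G\<^esub> g) *\<^sub>v w" if "h \<in> carrier G" for h
      using assoc_mult_mat_vec[OF R(2)[OF that] R(2)[OF g] wc] R(4)[OF that g] by simp
    then show ?thesis using w g R(2)[OF g] by (auto simp: W_def)
  qed
  ultimately have "W = {0\<^sub>v n} \<or> W = carrier_vec n" using is_irr_repD[OF irr] by blast
  moreover have "v \<in> W"
  proof -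
    have "\<exists>c. E *\<^sub>v (\<rho> g *\<^sub>v v) = c \<cdot>\<^sub>v v" if g: "g \<in> carrier G" for g
    proof -
      obtain c where c: "E * \<rho> g * E = c \<cdot>\<^sub>m E" using cut[OF g] by blast
      have "E *\<^sub>v (\<rho> g *\<^sub>v v) = (E * \<rho> g * E) *\<^sub>v u"
        unfolding v_def using E R(2)[OF g] u by (simp add: assoc_mult_mat_vec[of _ n n _ n])
      also have "\<dots> = c \<cdot>\<^sub>v v" unfolding c v_def by (rule smult_mat_mult_vec[OF E u])
      finally show ?thesis by blast
    qed
    then show ?thesis using v by (auto simp: W_def)
  qed
  ultimately have W: "W = carrier_vec n" using v(2) by auto
  have "\<exists>c. E *\<^sub>v w = c \<cdot>\<^sub>v v" if "w \<in> carrier_vec n" for w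
  proof -
    have "\<exists>c. E *\<^sub>v (\<rho> \<one>\<^bsub>G\<^esub> *\<^sub>v w) = c \<cdot>\<^sub>v v" using that W by (auto simp: W_def)
    then show ?thesis using R(3) that by simp
  qed
  then have "\<forall>j. j < n \<longrightarrow> (\<exists>c. col E j = c \<cdot>\<^sub>v v)"
    using mult_mat_vec_unit[OF E] by (metis unit_vec_carrier)
  then obtain f where f: "\<And>j. j < n \<Longrightarrow> col E j = f j \<cdot>\<^sub>v v" by metis
  have Eij: "E $$ (i,j) = f j * v $ i" if "i < n" "j < n" for i j
  proof -
    have "E $$ (i,j) = col E j $ i" using E that by simp
    then show ?thesis using f[OF that(2)] v(1) that by simp
  qed
  \<comment> \<open>This sum is the trace of the rank one matrix \<open>E\<close> and also its
    eigenvalue at \<open>v\<close>. By \<open>EE\<close> that eigenvalue is \<open>card B\<close>,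
    and comparing the two gives the degree.\<close>
  have tr_f: "(\<Sum>j<n. f j * v $ j) = of_nat n"
    using trE Eij E by (simp add: mat_trace_def)
  have Ev: "E *\<^sub>v v = of_nat (card B) \<cdot>\<^sub>v v"
  proof -
    have "E *\<^sub>v v = (E * E) *\<^sub>v u" unfolding v_def using E u by (simp add: assoc_mult_mat_vec[of _ n n _ n])
    then show ?thesis unfolding EE v_def using smult_mat_mult_vec[OF E u] by simp
  qed
  obtain i where i: "i < n" "v $ i \<noteq> 0" using v by (metis carrier_vecD eq_vecI index_zero_vec)
  have "(E *\<^sub>v v) $ i = (\<Sum>j<n. f j * v $ j) * v $ i"
    using E i v(1) Eij by (auto simp: scalar_prod_def lessThan_atLeast0 sum_distrib_right intro!: sum.cong)
  then have "of_nat (card B) * v $ i = of_nat n * v $ i"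
    using Ev i v(1) tr_f by simp
  then have "(of_nat (card B) :: complex) = of_nat n" using i by simp
  then show ?thesis by (metis of_nat_eq_iff)
qed

section \<open>Tools for proving irreducibility\<close>

lemma subspace_eq_carrier_if_unit_vecs:
  assumes W: "is_subspace n W" and units: "\<And>x. x < n \<Longrightarrow> unit_vec n x \<in> W"
  shows "W = carrier_vec n"
proof -
  have "v \<in> W" if v: "v \<in> carrier_vec n" for v
  proof -
    \<comment> \<open>Induction over the truncations of \<open>v\<close>; each step adds one
      multiple of a unit vector.\<close>
    have "vec n (\<lambda>i. if i < k then v $ i else 0) \<in> W" if "k \<le> n" for k
      using that
    proof (induction k)
      case 0
      have "vec n (\<lambda>i. if i < 0 then v $ i else 0) = 0\<^sub>v n" by auto
      then show ?case using W by (simp add: is_subspace_def)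
    next
      case (Suc k)
      have "vec n (\<lambda>i. if i < Suc k then v $ i else 0) =
        vec n (\<lambda>i. if i < k then v $ i else 0) + v $ k \<cdot>\<^sub>v unit_vec n k"
        using Suc.prems by (intro eq_vecI) (auto simp: less_Suc_eq)
      moreover have "v $ k \<cdot>\<^sub>v unit_vec n k \<in> W"
        using W units[of k] Suc.prems by (simp add: is_subspace_def)
      moreover have "vec n (\<lambda>i. if i < k then v $ i else 0) \<in> W" using Suc by simp
      ultimately show ?case using W unfolding is_subspace_def by metis
    qed
    from this[of n] have "vec n (\<lambda>i. if i < n then v $ i else 0) \<in> W" by simp
    moreover have "vec n (\<lambda>i. if i < n then v $ i else 0) = v" using v by auto
    ultimately show ?thesis by simp
  qed
  then show ?thesis using W by (auto simp: is_subspace_def)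
qed

text \<open>Supplies the degree 1. A nonzero vector of a one-dimensional space spans it, by division
  by its only entry.\<close>

lemma trivial_irr_rep: "is_irr_rep G 1 (\<lambda>_. 1\<^sub>m 1)"
  unfolding is_irr_rep_def
proof (intro conjI allI impI)
  show "is_rep G 1 (\<lambda>_. 1\<^sub>m 1)" by (simp add: is_rep_def)
  fix W assume "is_subspace 1 W \<and> (\<forall>g\<in>carrier G. \<forall>w\<in>W. (1\<^sub>m 1 :: complex mat) *\<^sub>v w \<in> W)"
  then have W: "is_subspace 1 W" by simp
  show "W = {0\<^sub>v 1} \<or> W = carrier_vec 1"
  proof (cases "W = {0\<^sub>v 1}")
    case False
    then obtain w where w: "w \<in> W" "w \<noteq> 0\<^sub>v 1" using W by (auto simp: is_subspace_def)
    have wc: "w \<in> carrier_vec 1" using W w by (auto simp: is_subspace_def)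
    then have w0: "w $ 0 \<noteq> 0" using w(2) by (auto simp: vec_eq_iff)
    have "v \<in> W" if "v \<in> carrier_vec 1" for v
    proof -
      have "v = (v $ 0 / w $ 0) \<cdot>\<^sub>v w" using that wc w0 by (intro eq_vecI) auto
      then show ?thesis using W w(1) unfolding is_subspace_def by metis
    qed
    then show ?thesis using W by (auto simp: is_subspace_def)
  qed simp
qed

section \<open>Heisenberg groups over truncated polynomials\<close>

definition cong_on :: "nat \<Rightarrow> nat set \<Rightarrow> int fps \<Rightarrow> int fps \<Rightarrow> bool" where
  "cong_on p I a b \<longleftrightarrow> (\<forall>i\<in>I. int p dvd fps_nth a i - fps_nth b i)"

lemma cong_on_refl [simp]: "cong_on p I a a"
  by (simp add: cong_on_def)

text \<open>Two maps with the same fibres have ranges in bijection. This transfers the count of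
  residue functions to the group and its subgroups.\<close>

lemma bij_betw_range:
  assumes "\<And>x y. f x = f y \<longleftrightarrow> g x = g y"
  shows "bij_betw (\<lambda>y. g (inv_into UNIV f y)) (range f) (range g)"
proof -
  have fg: "g (inv_into UNIV f (f x)) = g x" for x using assms f_inv_into_f[of "f x" f UNIV] by blast
  show ?thesis
    by (rule bij_betwI'[of "range f"]) (use fg assms in auto)
qed

text \<open>A canonical form for congruence classes. \<open>restrict\<close> makes it extensional,
  so its range is a set of functions that can be counted.\<close>

definition residues_on :: "nat \<Rightarrow> nat set \<Rightarrow> int fps \<Rightarrow> nat \<Rightarrow> int" where
  "residues_on p I a = restrict (\<lambda>i. fps_nth a i mod int p) I"

lemma residues_on_eq_iff: "residues_on p I a = residues_on p I b \<longleftrightarrow> cong_on p I a b"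
  by (auto simp: residues_on_def cong_on_def fun_eq_iff restrict_def mod_eq_dvd_iff)

lemma range_residues_on:
  assumes "p > 0"
  shows "range (residues_on p I) = I \<rightarrow>\<^sub>E {0..<int p}"
proof (intro equalityI subsetI)
  fix f assume f: "f \<in> I \<rightarrow>\<^sub>E {0..<int p}"
  have "residues_on p I (Abs_fps f) = f"
    using f by (fastforce simp: residues_on_def PiE_def Pi_def extensional_def restrict_def)
  then show "f \<in> range (residues_on p I)" by (metis rangeI)
qed (use assms in \<open>auto simp: residues_on_def\<close>)

lemma card_range_residues_on:
  assumes "p > 0" "finite I"
  shows "card (range (residues_on p I)) = p ^ card I" "finite (range (residues_on p I))"
  using assms by (auto simp: range_residues_on card_PiE intro!: finite_PiE)

lemma card_range_cong_on:
  assumes "p > 0" "finite I" "\<And>a b. f a = f b \<longleftrightarrow> cong_on p I a b"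
  shows "card (range f) = p ^ card I" "finite (range f)"
proof -
  have "bij_betw (\<lambda>y. residues_on p I (inv_into UNIV f y)) (range f) (range (residues_on p I))"
    by (rule bij_betw_range) (simp add: assms residues_on_eq_iff)
  then show "card (range f) = p ^ card I" "finite (range f)"
    using card_range_residues_on[OF assms(1,2)] bij_betw_same_card bij_betw_finite by metis+
qed

text \<open>Every summand of coefficient \<open>k\<close> contains some \<open>fps_nth a i\<close>
  with \<open>i \<le> k < e\<close>.\<close>

lemma dvd_fps_mult_nth:
  fixes a b :: "int fps"
  assumes "\<And>i. i < e \<Longrightarrow> d dvd fps_nth a i" "k < e"
  shows "d dvd fps_nth (a * b) k"
  using assms by (auto simp: fps_mult_nth intro!: dvd_sum)

lemma cong_on_add: "cong_on p I a b \<Longrightarrow> cong_on p I c d \<Longrightarrow> cong_on p I (a + c) (b + d)"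
  unfolding cong_on_def by (auto simp: add_diff_add intro: dvd_add)

text \<open>Initial segments are compatible with products because coefficient \<open>k\<close>
  depends only on coefficients up to \<open>k\<close>. For this reason \<open>heis\<close> keeps all
  coefficients below \<open>m\<close> in its first two arguments even if \<open>S\<close> has
  gaps.\<close>

lemma cong_on_mult:
  assumes "cong_on p {..<e} a a'" "cong_on p {..<e} b b'"
  shows "cong_on p {..<e} (a * b) (a' * b')"
  unfolding cong_on_def
proof
  fix k assume k: "k \<in> {..<e}"
  have eq: "a * b - a' * b' = (a - a') * b + (b - b') * a'" by (simp add: algebra_simps)
  have "int p dvd fps_nth ((a - a') * b) k" "int p dvd fps_nth ((b - b') * a') k"
    using assms k by (auto intro!: dvd_fps_mult_nth[where e = e] simp: cong_on_def)
  then have "int p dvd fps_nth (a * b - a' * b') k" unfolding eq by (simp add: dvd_add)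
  then show "int p dvd fps_nth (a * b) k - fps_nth (a' * b') k" by simp
qed

text \<open>A monomial shifts the first coefficient of \<open>a\<close> that is invertible modulo
  \<open>p\<close> to position \<open>e - 1\<close> and rescales it to \<open>t\<close>. This is the
  nondegeneracy of the anti-triangular form.\<close>

lemma first_nonzero_mult:
  fixes a :: "int fps"
  assumes p: "prime p" and ex: "\<exists>i<e. \<not> int p dvd fps_nth a i"
  obtains b where "fps_cutoff e b = b" "\<And>k. k < e - 1 \<Longrightarrow> int p dvd fps_nth (a * b) k"
    "int p dvd fps_nth (a * b) (e - 1) - t"
proof -
  define i where "i = (LEAST i. \<not> int p dvd fps_nth a i)"
  have i: "\<not> int p dvd fps_nth a i" unfolding i_def using ex by (metis (mono_tags, lifting) LeastI)
  have least: "int p dvd fps_nth a j" if "j < i" for j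
    using not_less_Least that unfolding i_def by blast
  have ie: "i < e" using ex Least_le[of "\<lambda>i. \<not> int p dvd fps_nth a i"] unfolding i_def
    by (meson order.strict_trans1)
  have "coprime (fps_nth a i) (int p)"
    using i p prime_imp_coprime[of "int p" "fps_nth a i"] by (simp add: coprime_commute)
  then obtain u where u: "[fps_nth a i * u = 1] (mod int p)"
    using cong_solve_coprime_int by blast
  define b where "b = fps_const (u * t) * fps_X ^ (e - 1 - i)"
  have nth: "fps_nth (a * b) k = (if k < e - 1 - i then 0 else fps_nth a (k - (e - 1 - i)) * (u * t))" for k
  proof -
    have "a * b = (a * fps_const (u * t)) * fps_X ^ (e - 1 - i)" by (simp add: b_def mult.assoc)
    also have "fps_nth \<dots> k = (if k < e - 1 - i then 0 else fps_nth a (k - (e - 1 - i)) * (u * t))"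
      unfolding fps_X_power_mult_right_nth by simp
    finally show ?thesis .
  qed
  show ?thesis
  proof (rule that[of b])
    show "fps_cutoff e b = b"
      using ie by (auto simp: fps_eq_iff b_def fps_X_power_nth)
    show "int p dvd fps_nth (a * b) k" if "k < e - 1" for k
      using that ie least by (auto simp: nth)
    have "fps_nth (a * b) (e - 1) = fps_nth a i * u * t"
      using ie by (simp add: nth)
    moreover have "[fps_nth a i * u * t = 1 * t] (mod int p)"
      using u by (rule cong_scalar_right)
    ultimately show "int p dvd fps_nth (a * b) (e - 1) - t" by (simp add: cong_iff_dvd_diff)
  qed
qed

text \<open>
  Coordinates are power series over the integers instead of truncated polynomials over a finite field:
  \<open>el\<close> only sees coefficients modulo \<open>p\<close>, those below \<open>m\<close> for the first two arguments and those
  with index in \<open>S\<close> for the third. So group computations are identities in a commutative ring.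
\<close>

locale heis =
  fixes G :: "('g, 'c) monoid_scheme" (structure) and p m :: nat and S :: "nat set"
    and el :: "int fps \<Rightarrow> int fps \<Rightarrow> int fps \<Rightarrow> 'g"
  assumes p: "prime p" and S: "S \<subseteq> {..<m}" "S \<noteq> {}"
    and carrier_eq: "carrier G = {el a b z | a b z. True}"
    and mult: "el a b z \<otimes> el a' b' z' = el (a + a') (b + b') (z + z' + a * b')"
    and one: "\<one> = el 0 0 0"
    and el_eq_iff: "el a b z = el a' b' z' \<longleftrightarrow>
      cong_on p {..<m} a a' \<and> cong_on p {..<m} b b' \<and> cong_on p S z z'"
begin

section \<open>Group laws, order and nilpotence class\<close>

lemma p_gt_0: "p > 0" using p by (rule prime_gt_0_nat)

lemma el_closed [simp]: "el a b z \<in> carrier G"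
  by (auto simp: carrier_eq)

lemma elE:
  assumes "g \<in> carrier G"
  obtains a b z where "g = el a b z"
  using assms by (auto simp: carrier_eq)

lemma is_group: "group G"
proof (rule groupI)
  fix x y z assume "x \<in> carrier G" "y \<in> carrier G" "z \<in> carrier G"
  then show "(x \<otimes> y) \<otimes> z = x \<otimes> (y \<otimes> z)"
    by (auto elim!: elE simp: mult algebra_simps)
next
  fix x assume "x \<in> carrier G"
  then obtain a b z where x: "x = el a b z" by (rule elE)
  show "\<exists>y\<in>carrier G. y \<otimes> x = \<one>"
    by (rule bexI[of _ "el (- a) (- b) (a * b - z)"]) (auto simp: x mult one)
qed (auto elim!: elE simp: mult one)

sublocale group G by (rule is_group)

lemma inv_el: "inv (el a b z) = el (- a) (- b) (a * b - z)"
  by (rule inv_equality) (auto simp: mult one)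

text \<open>Collects the failure of commutativity in a central factor, on which an irreducible
  representation is scalar.\<close>

lemma twist: "el a b z \<otimes> el a' b' z' = el 0 0 (a * b' - a' * b) \<otimes> (el a' b' z' \<otimes> el a b z)"
  by (simp add: mult algebra_simps)

lemma grp_comm_el: "grp_comm G (el a b z) (el a' b' z') = el 0 0 (a * b' - a' * b)"
  by (simp add: grp_comm_def inv_el mult algebra_simps)

lemma central_subgroup: "subgroup {el 0 0 z | z. True} G"
  by (rule subgroupI) (auto simp: inv_el mult)

lemma card_carrier: "finite (carrier G)" "Coset.order G = p ^ (2 * m + card S)"
proof -
  let ?f = "\<lambda>(a,b,z). el a b z"
  let ?g = "\<lambda>(a,b,z). (residues_on p {..<m} a, residues_on p {..<m} b, residues_on p S z)"
  have "bij_betw (\<lambda>y. ?g (inv_into UNIV ?f y)) (range ?f) (range ?g)"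
    by (rule bij_betw_range) (auto simp: el_eq_iff residues_on_eq_iff)
  moreover have "range ?f = carrier G" by (auto simp: carrier_eq image_def)
  moreover have "range ?g = range (residues_on p {..<m}) \<times> range (residues_on p {..<m}) \<times> range (residues_on p S)"
    by (auto simp: image_def)
  ultimately have bij: "bij_betw (\<lambda>y. ?g (inv_into UNIV ?f y)) (carrier G)
      (range (residues_on p {..<m}) \<times> range (residues_on p {..<m}) \<times> range (residues_on p S))"
    by simp
  have "finite S" using S finite_subset by blast
  note c = card_range_residues_on[OF p_gt_0, of "{..<m}"] card_range_residues_on[OF p_gt_0 \<open>finite S\<close>]
  show "finite (carrier G)" using bij_betw_finite[OF bij] c by simp
  show "Coset.order G = p ^ (2 * m + card S)"
    using bij_betw_same_card[OF bij] c
    by (simp add: Coset.order_def card_cartesian_product power_add mult_2)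
qed

lemma finite_p_group: "finite_p_group p G"
  using card_carrier is_group by (auto simp: finite_p_group_def)

lemma nilpotent_class_2: "nilpotent_class G 2"
proof -
  obtain s where s: "s \<in> S" "s < m" using S by blast
  let ?Z = "{el 0 0 z | z. True}"
  let ?C = "{grp_comm G x y | x y. x \<in> lower_central G 0 \<and> y \<in> carrier G}"
  have "?C \<subseteq> ?Z" by (auto elim!: elE simp: grp_comm_el)
  then have sub: "lower_central G 1 \<subseteq> ?Z"
    using generate_subgroup_incl[OF _ central_subgroup] by simp
  \<comment> \<open>Since \<open>s\<close> lies in \<open>S\<close>, the third argument of
    \<open>el\<close> records this coefficient, so the commutator is nontrivial.\<close>
  have "el 0 0 (fps_X ^ s) = grp_comm G (el 1 0 0) (el 0 (fps_X ^ s) 0)"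
    by (simp add: grp_comm_el)
  then have "el 0 0 (fps_X ^ s) \<in> ?C" using el_closed by (metis (mono_tags, lifting) lower_central.simps(1) mem_Collect_eq)
  then have "el 0 0 (fps_X ^ s) \<in> lower_central G 1"
    by (auto intro: generate.incl)
  moreover have "el 0 0 (fps_X ^ s) \<noteq> \<one>"
    using s p by (auto simp: one el_eq_iff cong_on_def fps_X_power_nth intro!: bexI[of _ s])
  ultimately have "lower_central G 1 \<noteq> {\<one>}" by blast
  moreover from this have "lower_central G 0 \<noteq> {\<one>}"
    using \<open>el 0 0 (fps_X ^ s) \<noteq> \<one>\<close> el_closed by (metis lower_central.simps(1) singletonD)
  moreover have "lower_central G 2 = {\<one>}"
  proof -
    have "{grp_comm G x y | x y. x \<in> lower_central G 1 \<and> y \<in> carrier G} \<subseteq> {\<one>}"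
      using sub by (auto elim!: elE simp: grp_comm_el one subset_iff)
    then have "generate G {grp_comm G x y | x y. x \<in> lower_central G 1 \<and> y \<in> carrier G} \<subseteq> {\<one>}"
      using generate_subgroup_incl triv_subgroup by blast
    then show ?thesis using generate.one by (auto simp: numeral_2_eq_2)
  qed
  ultimately show ?thesis by (auto simp: nilpotent_class_def numeral_2_eq_2 less_Suc_eq)
qed

section \<open>Irreducible representations and their centers\<close>

definition level_subgroup :: "nat \<Rightarrow> 'g set" where
  "level_subgroup e = {el a b z | a b z. \<forall>i<e. int p dvd fps_nth a i \<and> int p dvd fps_nth b i}"

text \<open>Below \<open>m\<close>, \<open>el\<close> determines the coefficients of
  \<open>a\<close> and \<open>b\<close> modulo \<open>p\<close>, so with \<open>e \<le> m\<close>
  the condition does not depend on the chosen series.\<close>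

lemma el_in_level_subgroup_iff:
  assumes "e \<le> m"
  shows "el a b z \<in> level_subgroup e \<longleftrightarrow> (\<forall>i<e. int p dvd fps_nth a i \<and> int p dvd fps_nth b i)"
proof
  assume "el a b z \<in> level_subgroup e"
  then obtain a' b' z' where "el a b z = el a' b' z'"
    and *: "\<forall>i<e. int p dvd fps_nth a' i \<and> int p dvd fps_nth b' i"
    unfolding level_subgroup_def by blast
  then have "cong_on p {..<m} a a'" "cong_on p {..<m} b b'" by (auto simp: el_eq_iff)
  then show "\<forall>i<e. int p dvd fps_nth a i \<and> int p dvd fps_nth b i"
    using * assms unfolding cong_on_def
    by (metis dvd_diff_right_iff lessThan_iff order_less_le_trans zdvd_zdiffD)
qed (auto simp: level_subgroup_def)

text \<open>One number \<open>e\<close> governs both the degree and the center of the character,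
  which is \<open>level_subgroup e\<close>. Nestedness and the possible degrees are both read off
  from it.\<close>

lemma irr_rep_structure:
  assumes irr: "is_irr_rep G n \<rho>"
  obtains e where "e = 0 \<or> e - 1 \<in> S" "n = p ^ e"
    "\<And>g. g \<in> carrier G \<Longrightarrow> cmod (mat_trace (\<rho> g)) = n \<longleftrightarrow> g \<in> level_subgroup e"
proof -
  have rep: "is_rep G n \<rho>" using irr by (auto simp: is_irr_rep_def)
  note R = is_repD[OF rep]
  have "\<exists>c. \<rho> (el 0 0 z) = c \<cdot>\<^sub>m 1\<^sub>m n" for z
  proof (rule schur[OF irr])
    fix g assume "g \<in> carrier G"
    then show "\<rho> g * \<rho> (el 0 0 z) = \<rho> (el 0 0 z) * \<rho> g"
      by (auto elim!: elE simp: R(4)[symmetric] mult algebra_simps)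
  qed (simp add: R)
  \<comment> \<open>\<open>lam\<close> is the central character pulled back to series: it turns sums
    into products and sees only residues modulo \<open>p\<close> of coefficients with index in
    \<open>S\<close>.\<close>
  then obtain lam where lam: "\<And>z. \<rho> (el 0 0 z) = lam z \<cdot>\<^sub>m 1\<^sub>m n" by metis
  have lam_mult: "\<rho> (el 0 0 z \<otimes> g) = lam z \<cdot>\<^sub>m \<rho> g" if "g \<in> carrier G" for z g
  proof -
    have "\<rho> (el 0 0 z \<otimes> g) = (lam z \<cdot>\<^sub>m 1\<^sub>m n) * \<rho> g" using that by (simp add: R(4) lam)
    also have "\<dots> = lam z \<cdot>\<^sub>m (1\<^sub>m n * \<rho> g)"
      by (rule mult_smult_assoc_mat[OF one_carrier_mat R(2)[OF that]])
    finally show ?thesis using R(2)[OF that] by simp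
  qed
  have scalar_eqD: "c = d" if "c \<cdot>\<^sub>m 1\<^sub>m n = d \<cdot>\<^sub>m (1\<^sub>m n :: complex mat)" for c d
    using arg_cong[OF that, of "\<lambda>M. M $$ (0,0)"] R(1) by simp
  have lam_add: "lam (z + w) = lam z * lam w" for z w
  proof (rule scalar_eqD)
    have "lam (z + w) \<cdot>\<^sub>m 1\<^sub>m n = \<rho> (el 0 0 z \<otimes> el 0 0 w)" by (simp add: mult lam)
    also have "\<dots> = lam z * lam w \<cdot>\<^sub>m 1\<^sub>m n" using lam_mult[of "el 0 0 w" z] lam[of w]
      by (auto intro!: eq_matI)
    finally show "lam (z + w) \<cdot>\<^sub>m 1\<^sub>m n = lam z * lam w \<cdot>\<^sub>m 1\<^sub>m n" .
  qed
  have lam_cong: "lam z = lam w" if "cong_on p S z w" for z w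
    using that lam[of z] lam[of w] el_eq_iff[of 0 0 z 0 0 w] scalar_eqD by simp
  have lam_0: "lam 0 = 1"
  proof (rule scalar_eqD)
    show "lam 0 \<cdot>\<^sub>m 1\<^sub>m n = 1 \<cdot>\<^sub>m 1\<^sub>m n"
      using lam[of 0] R(3) one by (auto intro!: eq_matI)
  qed
  \<comment> \<open>\<open>triv e\<close> says that \<open>lam\<close> is trivial on series that are
    multiples of \<open>X^e\<close> modulo \<open>p\<close>. The level of the representation is the
    least such \<open>e\<close>.\<close>
  define triv where "triv e \<longleftrightarrow> (\<forall>z. (\<forall>i<e. int p dvd fps_nth z i) \<longrightarrow> lam z = 1)" for e
  have "triv m"
    unfolding triv_def
  proof (intro allI impI)
    fix z assume "\<forall>i<m. int p dvd fps_nth z i"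
    then have "lam z = lam 0" using S by (intro lam_cong) (auto simp: cong_on_def)
    then show "lam z = 1" using lam_0 by simp
  qed
  define e where "e = (LEAST e. triv e)"
  have triv_e: "triv e" unfolding e_def using \<open>triv m\<close> by (rule LeastI)
  have em: "e \<le> m" unfolding e_def using \<open>triv m\<close> by (rule Least_le)
  have pred: "\<exists>z. (\<forall>i<e-1. int p dvd fps_nth z i) \<and> lam z \<noteq> 1" if "e > 0"
    using not_less_Least[of "e - 1" triv] that unfolding e_def triv_def by auto
  \<comment> \<open>If \<open>e - 1\<close> were outside \<open>S\<close>, deleting that coefficient
    from a witness of minimality would not change \<open>lam\<close>, yet would leave a series on
    which \<open>lam\<close> is 1.\<close>
  have e_S: "e = 0 \<or> e - 1 \<in> S"
  proof (rule ccontr)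
    assume "\<not> ?thesis"
    then have e: "e > 0" "e - 1 \<notin> S" by auto
    obtain z where z: "\<forall>i<e-1. int p dvd fps_nth z i" "lam z \<noteq> 1" using pred[OF e(1)] by blast
    define w where "w = z - fps_const (fps_nth z (e-1)) * fps_X ^ (e-1)"
    have w: "fps_nth w i = (if i = e - 1 then 0 else fps_nth z i)" for i
      by (simp add: w_def fps_X_power_nth)
    have "lam z = lam w" using e(2) by (intro lam_cong) (auto simp: cong_on_def w)
    moreover have "\<forall>i<e. int p dvd fps_nth w i" using z(1) by (auto simp: w)
    then have "lam w = 1" using triv_e by (simp add: triv_def)
    ultimately show False using z(2) by simp
  qed
  \<comment> \<open>The product is made congruent below \<open>e\<close> to a series on which
    \<open>lam\<close> is not 1. The cutoff condition ensures that \<open>b\<close> yields an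
    element of the subgroup \<open>B\<close> defined below.\<close>
  have nondeg: "\<exists>b. fps_cutoff e b = b \<and> lam (a * b) \<noteq> 1" if ex: "\<exists>i<e. \<not> int p dvd fps_nth a i" for a
  proof -
    have "e > 0" using ex by auto
    then obtain z where z: "\<forall>i<e-1. int p dvd fps_nth z i" "lam z \<noteq> 1" using pred by blast
    obtain b where b: "fps_cutoff e b = b" "\<And>k. k < e - 1 \<Longrightarrow> int p dvd fps_nth (a * b) k"
      "int p dvd fps_nth (a * b) (e - 1) - fps_nth z (e - 1)"
      using first_nonzero_mult[OF p ex] by metis
    have "int p dvd fps_nth (z - a * b) i" if "i < e" for i
    proof (cases "i = e - 1")
      case True
      then show ?thesis using b(3) by (simp add: dvd_diff_commute)
    next
      case False
      then have "i < e - 1" using that by simp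
      then show ?thesis using b(2) z(1) by simp
    qed
    then have "lam (z - a * b) = 1" using triv_e by (simp add: triv_def)
    then have "lam z = lam (a * b)" using lam_add[of "z - a * b" "a * b"] by simp
    then show ?thesis using b(1) z(2) by auto
  qed
  have twisted: "\<rho> (el a b z \<otimes> el a' b' z') = lam (a * b' - a' * b) \<cdot>\<^sub>m \<rho> (el a' b' z' \<otimes> el a b z)"
    for a b z a' b' z'
    by (subst twist, subst lam_mult) auto
  have trace_zero: "mat_trace (\<rho> (el a b z)) = 0"
    if nz: "\<exists>i<e. \<not> int p dvd fps_nth a i \<or> \<not> int p dvd fps_nth b i" for a b z
  proof (cases "\<exists>i<e. \<not> int p dvd fps_nth a i")
    case True
    then obtain b' where "lam (a * b') \<noteq> 1" using nondeg by blast
    then show ?thesis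
      using trace_zero_if_twisted_comm[OF is_group rep _ _ twisted[of a b z 0 b' 0]] by simp
  next
    case False
    then obtain a' where "lam (b * a') \<noteq> 1" using nz nondeg by blast
    \<comment> \<open>Testing against \<open>- a'\<close> makes the twisting factor
      \<open>lam (a' * b)\<close>.\<close>
    then show ?thesis
      using trace_zero_if_twisted_comm[OF is_group rep _ _ twisted[of a b z "- a'" 0 0]]
      by (simp add: mult.commute)
  qed
  \<comment> \<open>All coefficients below \<open>e\<close> of the commutator series are divisible
    by \<open>p\<close>, so \<open>lam\<close> is 1 on it. The element then commutes with everything
    under \<open>\<rho>\<close>, and \<open>schur\<close> applies.\<close>
  have scalar: "\<exists>c. \<rho> (el a b z) = c \<cdot>\<^sub>m 1\<^sub>m n"
    if ab: "\<forall>i<e. int p dvd fps_nth a i \<and> int p dvd fps_nth b i" for a b z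
  proof (rule schur[OF irr])
    fix g assume "g \<in> carrier G"
    then obtain a' b' z' where g: "g = el a' b' z'" by (rule elE)
    have "int p dvd fps_nth (a * b' - a' * b) i" if "i < e" for i
      using dvd_fps_mult_nth[of e "int p" a i b'] dvd_fps_mult_nth[of e "int p" b i a'] ab that
      by (simp add: mult.commute)
    then have "lam (a * b' - a' * b) = 1" using triv_e by (simp add: triv_def)
    then have "\<rho> (el a b z \<otimes> g) = 1 \<cdot>\<^sub>m \<rho> (g \<otimes> el a b z)" using twisted g by metis
    then show "\<rho> g * \<rho> (el a b z) = \<rho> (el a b z) * \<rho> g"
      by (simp add: R(4)[symmetric] g) (auto intro!: eq_matI)
  qed (simp add: R)
  \<comment> \<open>A subgroup of order \<open>p^e\<close> whose nontrivial elements have trace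
    zero, as \<open>degree_eq_card\<close> requires.\<close>
  define B where "B = range (\<lambda>b. el 0 (fps_cutoff e b) 0)"
  have "el 0 (fps_cutoff e b) 0 = el 0 (fps_cutoff e b') 0 \<longleftrightarrow> cong_on p {..<e} b b'" for b b'
    using em by (auto simp: el_eq_iff cong_on_def)
  then have "card B = p ^ card {..<e}" "finite B"
    unfolding B_def by (rule card_range_cong_on[OF p_gt_0 finite_lessThan])+
  have sgB: "subgroup B G"
  proof (rule subgroupI)
    fix x assume "x \<in> B"
    then show "inv x \<in> B"
      by (auto simp: B_def inv_el fps_cutoff_uminus[symmetric])
  next
    fix x y assume "x \<in> B" "y \<in> B"
    then show "x \<otimes> y \<in> B"
      by (auto simp: B_def mult fps_cutoff_add[symmetric])
  qed (auto simp: B_def)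
  have "n = card B"
  proof (rule degree_eq_card[OF is_group irr sgB \<open>finite B\<close>])
    fix x assume x: "x \<in> B" "x \<noteq> \<one>"
    then obtain b where b: "x = el 0 (fps_cutoff e b) 0" by (auto simp: B_def)
    have "\<exists>i<e. \<not> int p dvd fps_nth b i"
      using x(2) by (auto simp: b one el_eq_iff cong_on_def split: if_splits)
    then show "mat_trace (\<rho> x) = 0" unfolding b by (intro trace_zero) auto
  next
    fix g assume "g \<in> carrier G"
    then obtain a b z where g: "g = el a b z" by (rule elE)
    show "(\<exists>c. \<exists>b\<in>B. \<rho> g = c \<cdot>\<^sub>m \<rho> b) \<or> (\<exists>c. \<exists>b\<in>B. c \<noteq> 1 \<and> \<rho> (g \<otimes> b) = c \<cdot>\<^sub>m \<rho> (b \<otimes> g))"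
    proof (cases "\<exists>i<e. \<not> int p dvd fps_nth a i")
      case True
      then obtain b' where b': "fps_cutoff e b' = b'" "lam (a * b') \<noteq> 1" using nondeg by blast
      have "el 0 b' 0 \<in> B" unfolding B_def using b'(1) by (metis rangeI)
      then show ?thesis using twisted[of a b z 0 b' 0] b'(2) g by auto
    next
      case False
      \<comment> \<open>Splits off the factor of \<open>g\<close> in \<open>B\<close>. The
        correction in the last coordinate offsets the term \<open>a * fps_cutoff e b\<close> created
        by the multiplication, and what remains lies in \<open>level_subgroup e\<close>.\<close>
      define x where "x = el a (b - fps_cutoff e b) (z - a * fps_cutoff e b)"
      have "\<exists>c. \<rho> x = c \<cdot>\<^sub>m 1\<^sub>m n" unfolding x_def using False by (intro scalar) auto
      then obtain c where c: "\<rho> x = c \<cdot>\<^sub>m 1\<^sub>m n" by blast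
      let ?y = "el 0 (fps_cutoff e b) 0"
      have "g = x \<otimes> ?y" by (simp add: x_def g mult)
      then have "\<rho> g = (c \<cdot>\<^sub>m 1\<^sub>m n) * \<rho> ?y" by (simp add: R(4) c[symmetric] x_def)
      also have "\<dots> = c \<cdot>\<^sub>m (1\<^sub>m n * \<rho> ?y)"
        by (rule mult_smult_assoc_mat[OF one_carrier_mat R(2)]) simp
      also have "1\<^sub>m n * \<rho> ?y = \<rho> ?y" using R(2)[of ?y] by simp
      finally show ?thesis by (auto simp: B_def)
    qed
  qed
  then have n: "n = p ^ e" using \<open>card B = p ^ card {..<e}\<close> by simp
  have "cmod (mat_trace (\<rho> g)) = n \<longleftrightarrow> g \<in> level_subgroup e" if gG: "g \<in> carrier G" for g
  proof -
    obtain a b z where g: "g = el a b z" using gG by (rule elE)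
    show ?thesis
    proof (cases "g \<in> level_subgroup e")
      case True
      then obtain c where "\<rho> g = c \<cdot>\<^sub>m 1\<^sub>m n"
        using scalar unfolding g el_in_level_subgroup_iff[OF em] by blast
      then show ?thesis
        using norm_trace_scalar[OF is_group card_carrier(1) rep gG] True by simp
    next
      case False
      then have "mat_trace (\<rho> g) = 0"
        unfolding g el_in_level_subgroup_iff[OF em] by (intro trace_zero) auto
      then show ?thesis using False R(1) by simp
    qed
  qed
  then show ?thesis using that e_S n by blast
qed

end

section \<open>Representations of every degree\<close>

text \<open>For \<open>p > 0\<close>, the standard faithful character of the integers modulo
  \<open>p\<close>, evaluated on integer representatives.\<close>

definition root_char :: "nat \<Rightarrow> int \<Rightarrow> complex" where
  "root_char p k = cis (2 * pi * of_int k / of_nat p)"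

lemma root_char_0 [simp]: "root_char p 0 = 1"
  by (simp add: root_char_def)

lemma root_char_add: "root_char p (k + l) = root_char p k * root_char p l"
  by (simp add: root_char_def cis_mult add_divide_distrib distrib_left)

lemma root_char_eq_1_iff:
  assumes "p > 0"
  shows "root_char p k = 1 \<longleftrightarrow> int p dvd k"
proof -
  have "root_char p k = 1 \<longleftrightarrow> cos (2 * pi * of_int k / of_nat p) = 1"
    unfolding root_char_def using cos_one_sin_zero by (auto simp: complex_eq_iff)
  also have "\<dots> \<longleftrightarrow> (\<exists>l::int. 2 * pi * of_int k / of_nat p = of_int l * 2 * pi)"
    by (simp add: cos_one_2pi_int)
  also have "\<dots> \<longleftrightarrow> (\<exists>l::int. k = int p * l)"
  proof (intro iff_exI)
    fix l :: int
    have "2 * pi * of_int k / of_nat p = of_int l * 2 * pi \<longleftrightarrow> real_of_int k = real_of_int (int p * l)"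
      using assms by (auto simp: field_simps)
    then show "2 * pi * of_int k / of_nat p = of_int l * 2 * pi \<longleftrightarrow> k = int p * l"
      by (simp only: of_int_eq_iff)
  qed
  finally show ?thesis by (simp add: dvd_def)
qed

lemma root_char_cong:
  assumes "p > 0" "int p dvd k - l"
  shows "root_char p k = root_char p l"
  using root_char_add[of p "k - l" l] root_char_eq_1_iff[OF assms(1), of "k - l"] assms(2) by simp

context heis
begin

text \<open>Only coefficients up to \<open>s\<close> enter coefficient \<open>s\<close> of a
  product, so functions on \<open>p^(s+1)\<close> points suffice. Diagonal matrices isolate a unit
  vector in any nonzero invariant subspace, and translations carry it to all others.\<close>

lemma exists_irr_rep:
  assumes s: "s \<in> S"
  shows "\<exists>\<rho>. is_irr_rep G (p ^ Suc s) \<rho>"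
proof -
  define e where "e = Suc s"
  define n where "n = p ^ e"
  have em: "e \<le> m" using S s by (auto simp: e_def)
  have n0: "n > 0" using p_gt_0 by (simp add: n_def)
  \<comment> \<open>Matrix indices are numbers below \<open>n\<close>: \<open>h\<close> numbers the
    residue classes of series, and \<open>D\<close> picks a representative for each number.\<close>
  obtain \<phi> where \<phi>: "bij_betw \<phi> (range (residues_on p {..<e})) {0..<n}"
    using ex_bij_betw_finite_nat card_range_residues_on[OF p_gt_0, of "{..<e}"]
    unfolding n_def by (metis card_lessThan finite_lessThan)
  define h where "h a = \<phi> (residues_on p {..<e} a)" for a
  have h_eq: "h a = h b \<longleftrightarrow> cong_on p {..<e} a b" for a b
    using bij_betw_imp_inj_on[OF \<phi>] by (auto simp: h_def inj_on_eq_iff residues_on_eq_iff[symmetric])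
  have h_less: "h a < n" for a
    using bij_betw_apply[OF \<phi>, of "residues_on p {..<e} a"] by (simp add: h_def)
  have "\<exists>a. h a = x" if "x < n" for x
    using bij_betw_imp_surj_on[OF \<phi>] that unfolding h_def by (metis atLeastLessThan_iff imageE le0)
  then obtain D where D: "\<And>x. x < n \<Longrightarrow> h (D x) = x" by metis
  have Dh: "cong_on p {..<e} (D (h a)) a" for a using D[OF h_less] h_eq by blast
  \<comment> \<open>The action \<open>f \<mapsto> (\<lambda>x. \<zeta>^((z + x b)_s) f (x + a))\<close> on functions on \<open>F_p^e\<close>, whose points
    are numbered by \<open>h\<close>.\<close>
  define M where "M a b z = mat n n (\<lambda>(x,y). if y = h (D x + a)
    then root_char p (fps_nth (z + D x * b) s) else 0)" for a b z
  have M_carrier [simp]: "M a b z \<in> carrier_mat n n" for a b z by (simp add: M_def)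
  have M_cong: "M a b z = M a' b' z'" if "el a b z = el a' b' z'" for a b z a' b' z'
  proof (rule eq_matI)
    fix x y assume "x < dim_row (M a' b' z')" "y < dim_col (M a' b' z')"
    then have xy: "x < n" "y < n" by (auto simp: M_def)
    have c: "cong_on p {..<e} a a'" "cong_on p {..<e} b b'" "int p dvd fps_nth z s - fps_nth z' s"
      using that em s unfolding el_eq_iff cong_on_def by auto
    have "h (D x + a) = h (D x + a')" unfolding h_eq using c(1) by (intro cong_on_add) auto
    moreover have "int p dvd fps_nth (D x * b) s - fps_nth (D x * b') s"
      using cong_on_mult[OF cong_on_refl c(2)] by (simp add: cong_on_def e_def)
    then have "int p dvd fps_nth (z + D x * b) s - fps_nth (z' + D x * b') s"
      using c(3) by (simp add: add_diff_add)
    then have "root_char p (fps_nth (z + D x * b) s) = root_char p (fps_nth (z' + D x * b') s)"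
      by (rule root_char_cong[OF p_gt_0])
    ultimately show "M a b z $$ (x, y) = M a' b' z' $$ (x, y)" using xy by (simp add: M_def)
  qed (auto simp: M_def)
  have M_mult: "M a b z * M a' b' z' = M (a + a') (b + b') (z + z' + a * b')" for a b z a' b' z'
  proof (rule eq_matI)
    fix x y assume "x < dim_row (M (a + a') (b + b') (z + z' + a * b'))"
      "y < dim_col (M (a + a') (b + b') (z + z' + a * b'))"
    then have xy: "x < n" "y < n" by (auto simp: M_def)
    define k where "k = h (D x + a)"
    have k: "k < n" by (simp add: k_def h_less)
    have Dk: "cong_on p {..<e} (D k) (D x + a)" unfolding k_def by (rule Dh)
    have "(M a b z * M a' b' z') $$ (x,y) = (\<Sum>j<n. M a b z $$ (x,j) * M a' b' z' $$ (j,y))"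
      using xy by (simp add: M_def scalar_prod_def lessThan_atLeast0)
    \<comment> \<open>Row \<open>x\<close> of \<open>M a b z\<close> has its only nonzero entry in
      column \<open>k\<close>.\<close>
    also have "\<dots> = (\<Sum>j<n. if j = k then root_char p (fps_nth (z + D x * b) s) * M a' b' z' $$ (k,y) else 0)"
      using xy by (intro sum.cong) (auto simp: M_def k_def)
    also have "\<dots> = root_char p (fps_nth (z + D x * b) s) * M a' b' z' $$ (k,y)"
      using k by simp
    also have "\<dots> = M (a + a') (b + b') (z + z' + a * b') $$ (x,y)"
    proof -
      have "h (D k + a') = h (D x + (a + a'))"
        unfolding h_eq add.assoc[symmetric] using Dk by (intro cong_on_add) auto
      moreover have "int p dvd fps_nth (D k * b') s - fps_nth ((D x + a) * b') s"
        using cong_on_mult[OF Dk cong_on_refl] by (simp add: cong_on_def e_def)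
      then have "root_char p (fps_nth (z' + D k * b') s) = root_char p (fps_nth (z' + (D x + a) * b') s)"
        by (intro root_char_cong[OF p_gt_0]) simp
      moreover have "fps_nth (z + z' + a * b' + D x * (b + b')) s =
          fps_nth (z + D x * b) s + fps_nth (z' + (D x + a) * b') s"
        unfolding fps_add_nth[symmetric] by (simp add: algebra_simps)
      ultimately show ?thesis using xy k by (simp add: M_def root_char_add del: fps_add_nth)
    qed
    finally show "(M a b z * M a' b' z') $$ (x,y) = M (a + a') (b + b') (z + z' + a * b') $$ (x,y)" .
  qed (auto simp: M_def)
  have M_one: "M 0 0 0 = 1\<^sub>m n"
    using D by (intro eq_matI) (auto simp: M_def)
  have M_vec: "(M a b z *\<^sub>v w) $ x = root_char p (fps_nth (z + D x * b) s) * w $ h (D x + a)"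
    if "x < n" "w \<in> carrier_vec n" for a b z w x
  proof -
    have "(M a b z *\<^sub>v w) $ x = (\<Sum>j<n. M a b z $$ (x,j) * w $ j)"
      using that by (auto simp: M_def scalar_prod_def lessThan_atLeast0)
    also have "\<dots> = (\<Sum>j<n. if j = h (D x + a) then root_char p (fps_nth (z + D x * b) s) * w $ j else 0)"
      using that by (intro sum.cong) (auto simp: M_def)
    also have "\<dots> = root_char p (fps_nth (z + D x * b) s) * w $ h (D x + a)"
      using h_less by simp
    finally show ?thesis .
  qed
  have "\<forall>g\<in>carrier G. \<exists>a b z. g = el a b z" by (metis elE)
  then obtain fa fb fz where f: "\<And>g. g \<in> carrier G \<Longrightarrow> g = el (fa g) (fb g) (fz g)" by metis
  \<comment> \<open>The coordinates of \<open>g\<close> are arbitrary choices; \<open>M_cong\<close>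
    makes the matrix independent of them.\<close>
  define \<rho> where "\<rho> g = M (fa g) (fb g) (fz g)" for g
  have \<rho>: "\<rho> (el a b z) = M a b z" for a b z
    unfolding \<rho>_def by (rule M_cong) (rule f[symmetric], simp)
  have "is_rep G n \<rho>"
    unfolding is_rep_def using n0
    by (auto simp: \<rho> one M_one mult M_mult elim!: elE)
  moreover have "W = {0\<^sub>v n} \<or> W = carrier_vec n"
    if W: "is_subspace n W" and inv: "\<forall>g\<in>carrier G. \<forall>w\<in>W. \<rho> g *\<^sub>v w \<in> W" for W
  proof (cases "W = {0\<^sub>v n}")
    case False
    have W_carrier: "w \<in> carrier_vec n" if "w \<in> W" for w using W that by (auto simp: is_subspace_def)
    have W_inv: "M a b z *\<^sub>v w \<in> W" if "w \<in> W" for a b z w using inv that el_closed by (metis \<rho>)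
    have W_lin: "v + c \<cdot>\<^sub>v w \<in> W" if "v \<in> W" "w \<in> W" for c v w
      using W that by (simp add: is_subspace_def)
    define supp where "supp w = {x. x < n \<and> w $ x \<noteq> 0}" for w :: "complex vec"
    have "\<exists>w. w \<in> W \<and> w \<noteq> 0\<^sub>v n" using False W by (auto simp: is_subspace_def)
    \<comment> \<open>A vector of minimal support is a multiple of a unit vector, because the matrices \<open>M 0 b 0\<close>
      are diagonal and jointly separate the indices.\<close>
    then obtain w where w: "w \<in> W" "w \<noteq> 0\<^sub>v n"
      and least: "\<And>v. v \<in> W \<Longrightarrow> v \<noteq> 0\<^sub>v n \<Longrightarrow> card (supp w) \<le> card (supp v)"
      using ex_has_least_nat[of "\<lambda>w. w \<in> W \<and> w \<noteq> 0\<^sub>v n" _ "\<lambda>w. card (supp w)"] by blast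
    note wc = W_carrier[OF w(1)]
    obtain y where y: "y < n" "w $ y \<noteq> 0" using w(2) wc by (metis carrier_vecD eq_vecI index_zero_vec)
    have zero: "w $ x = 0" if x: "x < n" "x \<noteq> y" for x
    proof (rule ccontr)
      assume wx: "w $ x \<noteq> 0"
      \<comment> \<open>The entries of \<open>M 0 b 0\<close> at \<open>x\<close> and
        \<open>y\<close> differ by the factor given by coefficient \<open>s = e - 1\<close> of
        \<open>d * b\<close>. Choosing \<open>b\<close> to make this coefficient 1 modulo
        \<open>p\<close> separates them.\<close>
      define d where "d = D y - D x"
      have "h (D x) \<noteq> h (D y)" using D x y by simp
      then have "\<exists>i<e. \<not> int p dvd fps_nth d i" unfolding h_eq by (auto simp: cong_on_def d_def dvd_diff_commute)
      then obtain b where b: "int p dvd fps_nth (d * b) (e - 1) - 1"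
        using first_nonzero_mult[OF p, of e d 1] by metis
      have "\<not> int p dvd fps_nth (d * b) s"
      proof
        assume "int p dvd fps_nth (d * b) s"
        then have "int p dvd 1" using b by (metis diff_Suc_1 dvd_diffD1 e_def zdvd_zdiffD dvd_diff_commute)
        then show False using p by auto
      qed
      then have ne: "root_char p (fps_nth (D y * b) s) \<noteq> root_char p (fps_nth (D x * b) s)"
        using root_char_add[of p "fps_nth (d * b) s" "fps_nth (D x * b) s"]
          root_char_eq_1_iff[OF p_gt_0, of "fps_nth (d * b) s"]
        by (auto simp: d_def left_diff_distrib root_char_def)
      \<comment> \<open>Subtracting the eigenvalue at \<open>x\<close> kills entry \<open>x\<close>
        but keeps entry \<open>y\<close>, so the support shrinks strictly.\<close>
      define v where "v = M 0 b 0 *\<^sub>v w + (- root_char p (fps_nth (D x * b) s)) \<cdot>\<^sub>v w"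
      have vW: "v \<in> W" unfolding v_def by (intro W_lin W_inv w)
      have v: "v $ k = (root_char p (fps_nth (D k * b) s) - root_char p (fps_nth (D x * b) s)) * w $ k"
        if "k < n" for k
        using that wc M_vec[OF that wc, of 0 b 0] D[OF that] by (simp add: v_def algebra_simps)
      have "v $ y \<noteq> 0" using v[OF y(1)] ne y by simp
      then have "v \<noteq> 0\<^sub>v n" using y by auto
      moreover have "supp v \<subset> supp w"
      proof
        show "supp v \<subseteq> supp w" unfolding supp_def using v by fastforce
        have "v $ x = 0" using v[OF x(1)] by simp
        then show "supp v \<noteq> supp w" using x(1) wx unfolding supp_def by blast
      qed
      then have "card (supp v) < card (supp w)" by (intro psubset_card_mono) (auto simp: supp_def)
      ultimately show False using least[OF vW] by simp
    qed
    have "unit_vec n y = 0 \<cdot>\<^sub>v w + (1 / w $ y) \<cdot>\<^sub>v w"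
      using y zero wc by (intro eq_vecI) auto
    then have unit: "unit_vec n y \<in> W" using W_lin W w(1) unfolding is_subspace_def by metis
    have "unit_vec n x \<in> W" if x: "x < n" for x
    proof -
      \<comment> \<open>Translation by the difference carries the unit vector at \<open>y\<close> to
        the one at \<open>x\<close>.\<close>
      have "M (D y - D x) 0 0 *\<^sub>v unit_vec n y = unit_vec n x"
      proof (rule eq_vecI)
        fix k assume "k < dim_vec (unit_vec n x :: complex vec)"
        then have k: "k < n" by simp
        have "h (D k + (D y - D x)) = h (D y) \<longleftrightarrow> h (D k) = h (D x)"
          unfolding h_eq by (simp add: cong_on_def algebra_simps)
        then have "h (D k + (D y - D x)) = y \<longleftrightarrow> k = x" using D x k y by simp
        then show "(M (D y - D x) 0 0 *\<^sub>v unit_vec n y) $ k = unit_vec n x $ k"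
          using M_vec[OF k, of "unit_vec n y" "D y - D x" 0 0] k h_less y(1) x by simp
      qed (simp add: M_def)
      then show ?thesis using W_inv[OF unit] by metis
    qed
    then show ?thesis using subspace_eq_carrier_if_unit_vecs[OF W] by blast
  qed simp
  ultimately have "is_irr_rep G n \<rho>" by (auto simp: is_irr_rep_def)
  then show ?thesis by (auto simp: n_def e_def)
qed

section \<open>Nestedness and the set of degrees\<close>

lemma nested: "nested_by_degrees G"
  unfolding nested_by_degrees_def
proof (intro ballI impI)
  fix \<chi> \<psi> assume "\<chi> \<in> Irr G" "\<psi> \<in> Irr G" and le: "Re (\<psi> \<one>) \<le> Re (\<chi> \<one>)"
  then obtain \<rho> n \<sigma> k where \<rho>: "is_irr_rep G n \<rho>" "\<chi> = restrict (\<lambda>g. mat_trace (\<rho> g)) (carrier G)"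
    and \<sigma>: "is_irr_rep G k \<sigma>" "\<psi> = restrict (\<lambda>g. mat_trace (\<sigma> g)) (carrier G)"
    by (auto simp: Irr_def)
  have one_eq: "\<chi> \<one> = of_nat n" "\<psi> \<one> = of_nat k"
    using \<rho> \<sigma> by (auto simp: is_irr_rep_def is_rep_def mat_trace_one)
  obtain i where i: "n = p ^ i" "\<And>g. g \<in> carrier G \<Longrightarrow> cmod (mat_trace (\<rho> g)) = n \<longleftrightarrow> g \<in> level_subgroup i"
    using irr_rep_structure[OF \<rho>(1)] by metis
  obtain j where j: "k = p ^ j" "\<And>g. g \<in> carrier G \<Longrightarrow> cmod (mat_trace (\<sigma> g)) = k \<longleftrightarrow> g \<in> level_subgroup j"
    using irr_rep_structure[OF \<sigma>(1)] by metis
  \<comment> \<open>Since \<open>p > 1\<close>, degrees compare like their exponents, and a smaller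
    exponent imposes fewer conditions in \<open>level_subgroup\<close>.\<close>
  have "j \<le> i" using le one_eq i(1) j(1) prime_gt_1_nat[OF p] by simp
  then have "level_subgroup i \<subseteq> level_subgroup j"
    unfolding level_subgroup_def by fastforce
  moreover have eq: "complex_of_real r = of_nat q \<longleftrightarrow> r = q" for r q
    by (metis of_real_eq_iff of_real_of_nat_eq)
  ultimately show "char_center G \<chi> \<subseteq> char_center G \<psi>"
    using i(2) j(2) unfolding char_center_def one_eq eq by (auto simp: \<rho>(2) \<sigma>(2))
qed

text \<open>No other degrees occur by \<open>irr_rep_structure\<close>; the listed ones are attained
  by the trivial representation and by \<open>exists_irr_rep\<close>.\<close>

lemma cd_eq: "cd G = of_nat ` (insert 1 ((\<lambda>s. p ^ Suc s) ` S))"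
proof (intro equalityI subsetI)
  fix x assume "x \<in> cd G"
  then obtain \<chi> where \<chi>: "\<chi> \<in> Irr G" "x = \<chi> \<one>" unfolding cd_def by blast
  then obtain n \<rho> where "is_irr_rep G n \<rho>" "\<chi> = restrict (\<lambda>g. mat_trace (\<rho> g)) (carrier G)"
    unfolding Irr_def by blast
  then have \<rho>: "is_irr_rep G n \<rho>" "x = mat_trace (\<rho> \<one>)" using \<chi>(2) by auto
  then have x: "x = of_nat n" by (simp add: is_irr_rep_def is_rep_def mat_trace_one)
  obtain e where e: "e = 0 \<or> e - 1 \<in> S" "n = p ^ e" using irr_rep_structure[OF \<rho>(1)] by metis
  have "n \<in> insert 1 ((\<lambda>s. p ^ Suc s) ` S)"
  proof (cases e)
    case (Suc s)
    then show ?thesis using e by auto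
  qed (use e in auto)
  then show "x \<in> of_nat ` (insert 1 ((\<lambda>s. p ^ Suc s) ` S))" using x by blast
next
  have deg: "of_nat n \<in> cd G" if "is_irr_rep G n \<rho>" for n \<rho>
  proof -
    have "restrict (\<lambda>g. mat_trace (\<rho> g)) (carrier G) \<in> Irr G" using that by (auto simp: Irr_def)
    moreover have "restrict (\<lambda>g. mat_trace (\<rho> g)) (carrier G) \<one> = of_nat n"
      using that by (simp add: is_irr_rep_def is_rep_def mat_trace_one)
    ultimately show ?thesis unfolding cd_def by (metis imageI)
  qed
  fix x :: complex assume "x \<in> of_nat ` (insert 1 ((\<lambda>s. p ^ Suc s) ` S))"
  then consider "x = of_nat 1" | s where "s \<in> S" "x = of_nat (p ^ Suc s)" by blast
  then show "x \<in> cd G"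
  proof cases
    case 1
    then show ?thesis using deg[OF trivial_irr_rep] by metis
  next
    case 2
    then show ?thesis using deg exists_irr_rep by metis
  qed
qed

end

section \<open>Construction of the group on natural numbers and conclusion\<close>

lemma heis_exists:
  assumes p: "prime p" and S: "S \<subseteq> {..<m}" "S \<noteq> {}"
  shows "\<exists>(G :: nat monoid) el. heis G p m S el"
proof -
  let ?R = "\<lambda>(a,b,z). (residues_on p {..<m} a, residues_on p {..<m} b, residues_on p S z)"
  have p0: "p > 0" using p by (rule prime_gt_0_nat)
  have "finite S" using S finite_subset by blast
  have "range ?R \<subseteq> range (residues_on p {..<m}) \<times> range (residues_on p {..<m}) \<times> range (residues_on p S)"
    by auto
  then have "finite (range ?R)"
    by (rule finite_subset) (use card_range_residues_on[OF p0] \<open>finite S\<close> in auto)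
  \<comment> \<open>The group elements are to be natural numbers, so the finitely many triples of
    residue functions are coded injectively.\<close>
  then obtain f :: "_ \<Rightarrow> nat" where f: "inj_on f (range ?R)"
    using finite_imp_inj_to_nat_seg by metis
  define el where "el a b z = f (?R (a,b,z))" for a b z
  have el_eq: "el a b z = el a' b' z' \<longleftrightarrow>
      cong_on p {..<m} a a' \<and> cong_on p {..<m} b b' \<and> cong_on p S z z'" for a b z a' b' z'
  proof -
    have "el a b z = el a' b' z' \<longleftrightarrow> ?R (a,b,z) = ?R (a',b',z')"
      unfolding el_def by (rule inj_on_eq_iff[OF f]) (rule rangeI)+
    then show ?thesis by (simp add: residues_on_eq_iff)
  qed
  define C where "C = {el a b z | a b z. True}"
  have "\<forall>g\<in>C. \<exists>a b z. g = el a b z" by (auto simp: C_def)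
  then obtain fa fb fz where f: "\<And>g. g \<in> C \<Longrightarrow> g = el (fa g) (fb g) (fz g)" by metis
  \<comment> \<open>Products are computed on chosen representatives; compatibility of congruence
    with sums and products removes the dependence on the choice.\<close>
  define G where "G = \<lparr>carrier = C,
    monoid.mult = (\<lambda>x y. el (fa x + fa y) (fb x + fb y) (fz x + fz y + fa x * fb y)), one = el 0 0 0\<rparr>"
  have "heis G p m S el"
  proof
    fix a b z a' b' z'
    have "el a b z \<in> C" "el a' b' z' \<in> C" by (auto simp: C_def)
    then have c: "cong_on p {..<m} (fa (el a b z)) a" "cong_on p {..<m} (fb (el a b z)) b"
        "cong_on p S (fz (el a b z)) z" "cong_on p {..<m} (fa (el a' b' z')) a'"
        "cong_on p {..<m} (fb (el a' b' z')) b'" "cong_on p S (fz (el a' b' z')) z'"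
      using f el_eq by (metis (no_types))+
    \<comment> \<open>\<open>S\<close> need not be an initial segment, so the congruence of products
      is proved for all indices below \<open>m\<close> and then restricted.\<close>
    have "cong_on p {..<m} (fa (el a b z) * fb (el a' b' z')) (a * b')"
      using c by (intro cong_on_mult)
    then have "cong_on p S (fa (el a b z) * fb (el a' b' z')) (a * b')"
      using S by (auto simp: cong_on_def)
    then show "el a b z \<otimes>\<^bsub>G\<^esub> el a' b' z' = el (a + a') (b + b') (z + z' + a * b')"
      using c by (simp add: G_def el_eq cong_on_add)
  qed (use assms el_eq in \<open>auto simp: G_def C_def\<close>)
  then show ?thesis by blast
qed

theorem theorem1p6:
  fixes p :: nat and A :: "nat set"
  assumes "prime p"
    and "finite A"
    and "\<forall>a \<in> A. \<exists>k. a = p ^ k"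
    and "1 \<in> A"
    and "card A \<ge> 2"
  shows "\<exists>G :: nat monoid. finite_p_group p G \<and> nilpotent_class G 2 \<and>
           nested_by_degrees G \<and> cd G = of_nat ` A"
proof -
  \<comment> \<open>The form at coefficient \<open>s\<close> involves the \<open>s + 1\<close>
    coefficients from 0 to \<open>s\<close> and gives degree \<open>p^(s+1)\<close>, hence the shift
    by one.\<close>
  define S where "S = {s. p ^ Suc s \<in> A}"
  have A: "A = insert 1 ((\<lambda>s. p ^ Suc s) ` S)"
  proof (intro equalityI subsetI)
    fix a assume a: "a \<in> A"
    then obtain k where "a = p ^ k" using assms(3) by blast
    then show "a \<in> insert 1 ((\<lambda>s. p ^ Suc s) ` S)"
      using a by (cases k) (auto simp: S_def)
  qed (use assms(4) in \<open>auto simp: S_def\<close>)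
  have "inj (\<lambda>s. p ^ Suc s)"
    using prime_gt_1_nat[OF assms(1)] by (auto simp: inj_def)
  then have "finite S"
    using finite_vimageI[OF assms(2), of "\<lambda>s. p ^ Suc s"] by (simp add: S_def vimage_def)
  then obtain m where m: "S \<subseteq> {..<m}"
    using finite_nat_iff_bounded by blast
  have "S \<noteq> {}" using A assms(5) by auto
  then obtain G :: "nat monoid" and el where "heis G p m S el"
    using heis_exists[OF assms(1) m] by blast
  then interpret heis G p m S el .
  show ?thesis
    using finite_p_group nilpotent_class_2 nested cd_eq A by metis
qed

end
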